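(* Let $\Delta\ge 4$ be an integer. The unique (up to replacing elements by their negatives) minimal Markov basis for $\Lambda(B_\Delta)$ contains a Markov move of degree $4\left(\left\lfloor \frac{\Delta}{2} \right\rfloor - 1\right)^2 + 2$.
   Context: For a positive integer $\Delta$, $B_\Delta$ is the $(3\Delta-1)\times\binom{\Delta+1}{2}$ integer matrix whose columns are indexed by pairs $ij$ with $1\le i\le j\le\Delta$ (in lexicographic order) and whose entries are as follows. For a row $a$ with $1\le a\le\Delta$, $B_\Delta(a,ij)=2$ if $i=j=a$, $=1$ if exactly one of $i,j$ equals $a$, and $=0$ otherwise. For $2\le\kappa\le2\Delta$, the row $\kappa+\Delta-1$ has $B_\Delta(\kappa+\Delta-1,ij)=1$ if $i+j=\kappa$ and $0$ otherwise. Its Lawrence lifting is the block matrix $$\Lambda(B_\Delta)=\begin{pmatrix} B_\Delta & \mathbf{0}\\ I & I\end{pmatrix},$$ where $\mathbf{0}$ is the zero matrix of size $(3\Delta-1)\times\binom{\Delta+1}{2}$ and $I$ is the identity matrix of size $\binom{\Delta+1}{2}$. For an integer matrix $A$ with $n$ columns, $\ker_{\mathbb{Z}}(A)=\{\mathbf{u}\in\mathbb{Z}^n : A\mathbf{u}=\mathbf{0}\}$, and $\mathbb{N}$ includes $0$. A finite set $\mathcal{M}=\{\mathbf{b}_1,\dots,\mathbf{b}_M\}\subseteq\ker_{\mathbb{Z}}(A)$ is a Markov basis for $A$ if for all $\mathbf{u},\mathbf{v}\in\mathbb{N}^n$ with $A\mathbf{u}=A\mathbf{v}$ there exist $i_1,\dots,i_L\in\{1,\dots,M\}$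 and $s_1,\dots,s_L\in\{-1,1\}$ such that $\mathbf{u}+\sum_{j=1}^L s_j\mathbf{b}_{i_j}=\mathbf{v}$ and $\mathbf{u}+\sum_{j=1}^{\ell}s_j\mathbf{b}_{i_j}\ge\mathbf{0}$ (entrywise) for all $1\le\ell\le L$. It is minimal if no proper subset of it is a Markov basis for $A$. The elements of a Markov basis are called Markov moves. It is a known fact that the Lawrence lifting of any integer matrix has a unique minimal Markov basis up to signs of its elements. The degree of a move $\mathbf{u}\in\ker_{\mathbb{Z}}(\Lambda(B_\Delta))$ is the sum of its positive entries (equivalently, the sum of the absolute values of its negative entries). *)

theory Defs
  imports "Jordan_Normal_Form.Matrix_Kernel"
begin

text \<open>The column labels \<open>(i, j)\<close> with \<open>1 \<le> i \<le> j \<le> \<Delta>\<close>, in lexicographic order.\<close>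

definition col_pairs :: "nat \<Rightarrow> (nat \<times> nat) list" where
  "col_pairs \<Delta> = concat (map (\<lambda>i. map (\<lambda>j. (i, j)) [i..<Suc \<Delta>]) [1..<Suc \<Delta>])"

lemma set_col_pairs: "set (col_pairs \<Delta>) = {(i, j). 1 \<le> i \<and> i \<le> j \<and> j \<le> \<Delta>}"
  by (force simp: col_pairs_def simp del: upt_Suc)

lemma length_col_pairs: "length (col_pairs \<Delta>) = Suc \<Delta> choose 2"
proof -
  have "length (col_pairs \<Delta>) = (\<Sum>i = 1..<Suc \<Delta>. Suc \<Delta> - i)"
    by (simp only: col_pairs_def length_concat map_map comp_def length_map length_upt
        interv_sum_list_conv_sum_set_nat set_upt)
  also have "\<dots> = (\<Sum>i = 1..<Suc \<Delta>. i)"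
    by (rule sum.reindex_bij_witness[of _ "\<lambda>i. Suc \<Delta> - i" "\<lambda>i. Suc \<Delta> - i"]) auto
  also have "\<dots> = Suc \<Delta> choose 2"
    by (induction \<Delta>) (simp_all add: numeral_2_eq_2)
  finally show ?thesis .
qed

text \<open>The argument \<open>r\<close> is the row number counted from 1.  The rows \<open>r > \<Delta>\<close> are the rows
  \<open>r = \<kappa> + \<Delta> - 1\<close> with \<open>2 \<le> \<kappa> \<le> 2 * \<Delta>\<close>, so the condition \<open>i + j = \<kappa>\<close> reads
  \<open>i + j + \<Delta> = r + 1\<close>.\<close>

definition B_entry :: "nat \<Rightarrow> nat \<Rightarrow> nat \<times> nat \<Rightarrow> int" where
  "B_entry \<Delta> r = (\<lambda>(i, j).
     if r \<le> \<Delta> then (if i = r \<and> j = r then 2 else if i = r \<or> j = r then 1 else 0)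
     else (if i + j + \<Delta> = r + 1 then 1 else 0))"

definition B_mat :: "nat \<Rightarrow> int mat" where
  "B_mat \<Delta> = mat (3 * \<Delta> - 1) (Suc \<Delta> choose 2) (\<lambda>(r, c). B_entry \<Delta> (Suc r) (col_pairs \<Delta> ! c))"

definition lawrence_lifting :: "int mat \<Rightarrow> int mat" where
  "lawrence_lifting A = four_block_mat
     A                  (0\<^sub>m (dim_row A) (dim_col A))
     (1\<^sub>m (dim_col A))  (1\<^sub>m (dim_col A))"

text \<open>The position \<open>u + (\<Sum>j = 1..l. s j * b j)\<close> reached from \<open>u\<close> after \<open>l\<close> signed moves.\<close>

definition walk :: "int vec \<Rightarrow> (nat \<Rightarrow> int) \<Rightarrow> (nat \<Rightarrow> int vec) \<Rightarrow> nat \<Rightarrow> int vec" where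
  "walk u s b l = vec (dim_vec u) (\<lambda>k. u $ k + (\<Sum>j = 1..l. s j * b j $ k))"

text \<open>Vectors over the natural numbers are nonnegative integer vectors.  The walk may have
  length \<open>L = 0\<close>, which settles the case \<open>u = v\<close>.\<close>

definition markov_basis :: "int mat \<Rightarrow> int vec set \<Rightarrow> bool" where
  "markov_basis A M \<longleftrightarrow>
     finite M \<and> M \<subseteq> mat_kernel A \<and>
     (\<forall>u v. u \<in> carrier_vec (dim_col A) \<longrightarrow> v \<in> carrier_vec (dim_col A) \<longrightarrow>
        0\<^sub>v (dim_col A) \<le> u \<longrightarrow> 0\<^sub>v (dim_col A) \<le> v \<longrightarrow> A *\<^sub>v u = A *\<^sub>v v \<longrightarrow>
        (\<exists>L b s. (\<forall>j\<in>{1..L}. b j \<in> M \<and> s j \<in> {-1, 1}) \<and>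
           walk u s b L = v \<and>
           (\<forall>l\<in>{1..L}. 0\<^sub>v (dim_col A) \<le> walk u s b l)))"

definition minimal_markov_basis :: "int mat \<Rightarrow> int vec set \<Rightarrow> bool" where
  "minimal_markov_basis A M \<longleftrightarrow> markov_basis A M \<and> (\<forall>M'. M' \<subset> M \<longrightarrow> \<not> markov_basis A M')"

definition equal_up_to_signs :: "int vec set \<Rightarrow> int vec set \<Rightarrow> bool" where
  "equal_up_to_signs M M' \<longleftrightarrow> (\<exists>f. (\<forall>b\<in>M. f b = b \<or> f b = - b) \<and> M' = f ` M)"

definition move_degree :: "int vec \<Rightarrow> int" where
  "move_degree u = (\<Sum>i\<in>{i. i < dim_vec u \<and> 0 < u $ i}. u $ i)"

end

theory Submission
  imports Defs
begin

text \<open>The kernel of \<open>\<Lambda>(A)\<close> consists of the vectors \<open>(v, -v)\<close> with \<open>v \<in> ker A\<close>.  This antisymmetry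
  forces every Markov basis of \<open>\<Lambda>(A)\<close> to contain every conformally minimal kernel vector (Graver
  element) up to sign; conversely one representative of each pair \<open>\<plusminus>w\<close> is a Markov basis, because
  a kernel vector decomposes conformally.  So the minimal Markov bases are the sign choices for the
  Graver elements, and the degree of \<open>(g, -g)\<close> is the 1-norm of \<open>g\<close>.

  With \<open>k = \<lfloor>\<Delta>/2\<rfloor> - 2\<close>, the required Graver element \<open>g\<close> of \<open>B\<^sub>\<Delta>\<close> has exactly two nonzero entries,
  of opposite signs, on each antidiagonal \<open>i + j = \<kappa>\<close> that it meets.  Below, \<open>[i j]\<close> is the unit
  vector of the column \<open>ij\<close>:
  \<open>2 (k - i) ([2i+3 2i+3] - [2i+1 2i+5])\<close> and \<open>2 (i + 1) ([2i+4 2i+4] - [2i+2 2i+6])\<close> for \<open>i < k\<close>,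
  \<open>[2 2] - [1 3]\<close>, \<open>[2k+3 2k+3] - [2k+2 2k+4]\<close> and \<open>(2k + 1) ([1 2k+4] - [3 2k+2])\<close>.
  The first two families act on the odd and on the even vertices as second differences, so the
  vertex equations make the coefficients along each of them linear, and the remaining equations fix
  all coefficients up to a common factor.  That factor is the entry at \<open>[2 2]\<close>, where \<open>g\<close> is 1,
  and therefore \<open>g\<close> is conformally minimal.\<close>

section \<open>Integer kernels of matrices\<close>

lemma mem_mat_kernel:
  "v \<in> mat_kernel A \<longleftrightarrow>
     dim_vec v = dim_col A \<and> (\<forall>r<dim_row A. (\<Sum>k<dim_col A. A $$ (r, k) * v $ k) = 0)"
proof -
  have "(A *\<^sub>v v) $ r = (\<Sum>k<dim_col A. A $$ (r, k) * v $ k)"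
    if "dim_vec v = dim_col A" "r < dim_row A" for r
    using that by (simp add: scalar_prod_def atLeast0LessThan)
  then have "A *\<^sub>v v = 0\<^sub>v (dim_row A) \<longleftrightarrow>
      (\<forall>r<dim_row A. (\<Sum>k<dim_col A. A $$ (r, k) * v $ k) = 0)"
    if "dim_vec v = dim_col A"
    unfolding vec_eq_iff using that by (simp del: index_mult_mat_vec)
  moreover have "v \<in> mat_kernel A \<longleftrightarrow>
      dim_vec v = dim_col A \<and> A *\<^sub>v v = 0\<^sub>v (dim_row A)"
    unfolding mat_kernel_def carrier_vec_def by blast
  ultimately show ?thesis by blast
qed

lemma mat_kernel_linear:
  assumes "u \<in> mat_kernel A" "v \<in> mat_kernel A"
  shows "u + v \<in> mat_kernel A" "u - v \<in> mat_kernel A" "- u \<in> mat_kernel A"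
proof -
  have "(\<Sum>k<dim_col A. A $$ (r, k) * (u + v) $ k) = 0" if "r < dim_row A" for r
  proof -
    have "(\<Sum>k<dim_col A. A $$ (r, k) * (u + v) $ k) =
        (\<Sum>k<dim_col A. A $$ (r, k) * u $ k) + (\<Sum>k<dim_col A. A $$ (r, k) * v $ k)"
      unfolding sum.distrib[symmetric] using assms
      by (intro sum.cong) (auto simp: mem_mat_kernel algebra_simps)
    then show ?thesis using assms that by (simp add: mem_mat_kernel)
  qed
  then show "u + v \<in> mat_kernel A" using assms by (simp add: mem_mat_kernel)
  have "(\<Sum>k<dim_col A. A $$ (r, k) * (u - v) $ k) = 0" if "r < dim_row A" for r
  proof -
    have "(\<Sum>k<dim_col A. A $$ (r, k) * (u - v) $ k) =
        (\<Sum>k<dim_col A. A $$ (r, k) * u $ k) - (\<Sum>k<dim_col A. A $$ (r, k) * v $ k)"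
      unfolding sum_subtractf[symmetric] using assms
      by (intro sum.cong) (auto simp: mem_mat_kernel algebra_simps)
    then show ?thesis using assms that by (simp add: mem_mat_kernel)
  qed
  then show "u - v \<in> mat_kernel A" using assms by (simp add: mem_mat_kernel)
  show "- u \<in> mat_kernel A" using assms(1)
    by (simp add: mem_mat_kernel sum_negf)
qed

lemma mat_kernel_diff_iff:
  fixes A :: "'a :: comm_ring_1 mat"
  assumes "u \<in> carrier_vec (dim_col A)" "v \<in> carrier_vec (dim_col A)"
  shows "v - u \<in> mat_kernel A \<longleftrightarrow> A *\<^sub>v u = A *\<^sub>v v"
proof -
  have "A *\<^sub>v (v - u) = A *\<^sub>v v - A *\<^sub>v u"
    using assms by (intro mult_minus_distrib_mat_vec) auto
  then show ?thesis using assms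
    by (auto simp: mat_kernel_def vec_eq_iff)
qed

subsection \<open>Conformal order and Graver basis\<close>

definition between0 :: "int \<Rightarrow> int \<Rightarrow> bool" where
  "between0 x y \<longleftrightarrow> (0 \<le> x \<and> x \<le> y) \<or> (y \<le> x \<and> x \<le> 0)"

definition conformal :: "int vec \<Rightarrow> int vec \<Rightarrow> bool" where
  "conformal v w \<longleftrightarrow> dim_vec v = dim_vec w \<and> (\<forall>k<dim_vec w. between0 (v $ k) (w $ k))"

text \<open>Both signs of every conformally minimal vector are kept, so this is closed under
  negation; Markov bases are compared with it only up to sign.\<close>

definition graver :: "int mat \<Rightarrow> int vec set" where
  "graver A = {w \<in> mat_kernel A. w \<noteq> 0\<^sub>v (dim_col A) \<and>
     (\<forall>v\<in>mat_kernel A. conformal v w \<longrightarrow> v = 0\<^sub>v (dim_col A) \<or> v = w)}"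

lemma conformal_uminus: "conformal (- v) (- w) \<longleftrightarrow> conformal v w"
  by (auto simp: conformal_def between0_def)

lemma conformal_trans: "conformal u v \<Longrightarrow> conformal v w \<Longrightarrow> conformal u w"
  unfolding conformal_def between0_def by fastforce

lemma uminus_graver:
  assumes "w \<in> graver A"
  shows "- w \<in> graver A"
proof -
  have w: "w \<in> mat_kernel A" "w \<noteq> 0\<^sub>v (dim_col A)" using assms by (auto simp: graver_def)
  have "v = 0\<^sub>v (dim_col A) \<or> v = - w" if "v \<in> mat_kernel A" "conformal v (- w)" for v
  proof -
    have "conformal (- v) w" using that(2) conformal_uminus[of "- v" w] by simp
    then have "- v = 0\<^sub>v (dim_col A) \<or> - v = w"
      using assms mat_kernel_linear(3)[OF that(1) that(1)] by (auto simp: graver_def)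
    then show ?thesis
      by (metis uminus_uminus_vec uminus_zero_vec)
  qed
  moreover have "- w \<noteq> 0\<^sub>v (dim_col A)"
    using w(2) by (metis uminus_uminus_vec uminus_zero_vec)
  ultimately show ?thesis using mat_kernel_linear(3)[OF w(1) w(1)] by (auto simp: graver_def)
qed

text \<open>Absolute values grow weakly in every coordinate, and strictly where \<open>v\<close> and
  \<open>w\<close> differ, since the signs agree there. This makes the 1-norm a natural-number
  measure for the descents below.\<close>

lemma conformal_norm_less:
  assumes "conformal v w" "v \<noteq> w"
  shows "(\<Sum>k<dim_vec w. nat \<bar>v $ k\<bar>) < (\<Sum>k<dim_vec w. nat \<bar>w $ k\<bar>)"
proof -
  obtain k where "k < dim_vec w" "v $ k \<noteq> w $ k"
    using assms by (metis conformal_def eq_vecI)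
  then show ?thesis using assms(1)
    by (intro sum_strict_mono_ex1) (force simp: conformal_def between0_def)+
qed

text \<open>Descent on the 1-norm: a nonzero kernel vector that is not Graver has a smaller nonzero
  kernel vector conformally below it.\<close>

lemma ex_graver_conformal:
  assumes "w \<in> mat_kernel A" "w \<noteq> 0\<^sub>v (dim_col A)"
  shows "\<exists>v\<in>graver A. conformal v w"
  using assms
proof (induction "\<Sum>k<dim_vec w. nat \<bar>w $ k\<bar>" arbitrary: w rule: less_induct)
  case less
  show ?case
  proof (cases "w \<in> graver A")
    case True
    then show ?thesis by (intro bexI[of _ w]) (auto simp: conformal_def between0_def)
  next
    case False
    then obtain v where v: "v \<in> mat_kernel A" "conformal v w" "v \<noteq> 0\<^sub>v (dim_col A)" "v \<noteq> w"
      using less.prems by (auto simp: graver_def)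
    then have "(\<Sum>k<dim_vec v. nat \<bar>v $ k\<bar>) < (\<Sum>k<dim_vec w. nat \<bar>w $ k\<bar>)"
      using conformal_norm_less[of v w] by (simp add: conformal_def)
    from less.hyps[OF this v(1,3)] show ?thesis using v(2) conformal_trans by blast
  qed
qed

lemma infinite_subset_between0:
  fixes x :: "nat \<Rightarrow> int"
  assumes "infinite I"
  shows "\<exists>J\<subseteq>I. infinite J \<and> (\<forall>i\<in>J. \<forall>j\<in>J. i < j \<longrightarrow> between0 (x i) (x j))"
proof -
  have "I = {i \<in> I. x i \<ge> 0} \<union> {i \<in> I. x i \<le> 0}" by auto
  then have "infinite {i \<in> I. x i \<ge> 0} \<or> infinite {i \<in> I. x i \<le> 0}"
    using assms by (metis finite_UnI)
  then obtain I' where I': "I' \<subseteq> I" "infinite I'" "(\<forall>i\<in>I'. x i \<ge> 0) \<or> (\<forall>i\<in>I'. x i \<le> 0)"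
    by (elim disjE) (use that[of "{i \<in> I. x i \<ge> 0}"] that[of "{i \<in> I. x i \<le> 0}"] in auto)
  \<comment> \<open>Keep the indices that no later index undercuts in absolute value. Beyond any
    \<open>N\<close>, an index minimizing the absolute value is of this kind, so \<open>J\<close> is
    unbounded.\<close>
  define J where "J = {i \<in> I'. \<forall>j\<in>I'. i < j \<longrightarrow> \<bar>x i\<bar> \<le> \<bar>x j\<bar>}"
  have "\<exists>i>N. i \<in> J" for N
  proof -
    obtain i0 where "i0 > N" "i0 \<in> I'" using I'(2) by (auto simp: infinite_nat_iff_unbounded)
    then obtain i where i: "i > N \<and> i \<in> I'"
        "\<And>j. j > N \<and> j \<in> I' \<Longrightarrow> nat \<bar>x i\<bar> \<le> nat \<bar>x j\<bar>"
      using ex_has_least_nat[of "\<lambda>i. i > N \<and> i \<in> I'" i0 "\<lambda>i. nat \<bar>x i\<bar>"] by auto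
    have "\<bar>x i\<bar> \<le> \<bar>x j\<bar>" if "j \<in> I'" "i < j" for j using i(1) i(2)[of j] that by auto
    then have "i \<in> J" using i(1) by (simp add: J_def)
    with i show ?thesis by auto
  qed
  then have "infinite J" by (auto simp: infinite_nat_iff_unbounded)
  moreover have "\<forall>i\<in>J. \<forall>j\<in>J. i < j \<longrightarrow> between0 (x i) (x j)"
    using I'(3) by (fastforce simp: J_def between0_def)
  ultimately show ?thesis using I'(1) by (intro exI[of _ J]) (auto simp: J_def)
qed

text \<open>Dickson's lemma, in the form needed for integer vectors.\<close>

lemma ex_infinite_conformal_chain:
  fixes x :: "nat \<Rightarrow> int vec"
  shows "\<exists>J. infinite J \<and> (\<forall>i\<in>J. \<forall>j\<in>J. i < j \<longrightarrow> (\<forall>k<n. between0 (x i $ k) (x j $ k)))"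
proof (induction n)
  case 0
  show ?case by (rule exI[of _ UNIV]) auto
next
  case (Suc n)
  then obtain J where J: "infinite J"
    "\<forall>i\<in>J. \<forall>j\<in>J. i < j \<longrightarrow> (\<forall>k<n. between0 (x i $ k) (x j $ k))" by blast
  obtain J' where "J' \<subseteq> J" "infinite J'"
    "\<forall>i\<in>J'. \<forall>j\<in>J'. i < j \<longrightarrow> between0 (x i $ n) (x j $ n)"
    using infinite_subset_between0[OF J(1), of "\<lambda>i. x i $ n"] by blast
  with J(2) show ?case
    by (intro exI[of _ J']) (auto simp: less_Suc_eq subset_iff)
qed

text \<open>An infinite Graver basis would contain two distinct conformally comparable elements by
  Dickson's lemma, against minimality.\<close>

lemma finite_graver: "finite (graver A)"
proof (rule ccontr)
  assume "infinite (graver A)"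
  then obtain x :: "nat \<Rightarrow> int vec" where x: "inj x" "range x \<subseteq> graver A"
    using infinite_countable_subset by blast
  obtain J where J: "infinite J"
    "\<forall>i\<in>J. \<forall>j\<in>J. i < j \<longrightarrow> (\<forall>k<dim_col A. between0 (x i $ k) (x j $ k))"
    using ex_infinite_conformal_chain[of "dim_col A" x] by blast
  obtain i where i: "i \<in> J" using J(1) by (metis finite.emptyI ex_in_conv)
  obtain j where j: "j \<in> J" "i < j" using J(1) by (auto simp: infinite_nat_iff_unbounded)
  have g: "x i \<in> graver A" "x j \<in> graver A" using x by auto
  then have "dim_vec (x i) = dim_col A" "dim_vec (x j) = dim_col A"
    by (auto simp: graver_def mem_mat_kernel)
  with J(2) i j have "conformal (x i) (x j)" by (auto simp: conformal_def)
  with g have "x i = x j" by (auto simp: graver_def)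
  with x(1) j(2) show False by (auto dest: injD)
qed

subsection \<open>Graver bases and Markov bases\<close>

lemma dim_walk: "dim_vec (walk u s b l) = dim_vec u"
  by (simp add: walk_def)

lemma walk_0: "walk u s b 0 = u"
  by (auto simp: walk_def)

lemma walk_Suc_index:
  "k < dim_vec u \<Longrightarrow> walk u s b (Suc l) $ k = walk u s b l $ k + s (Suc l) * b (Suc l) $ k"
  by (simp add: walk_def)

lemma walk_cong:
  assumes "\<And>j. j \<in> {1..l} \<Longrightarrow> s j = s' j \<and> b j = b' j"
  shows "walk u s b l = walk u s' b' l"
  unfolding walk_def using assms by (intro eq_vecI) (auto intro!: sum.cong)

text \<open>Induction on the 1-norm of \<open>v - u\<close>. A Graver element \<open>w\<close>
  conformal to \<open>v - u\<close> is split off as the last step: the walk goes from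
  \<open>u\<close> to \<open>v - w\<close> and then to \<open>v\<close>.\<close>

lemma markov_basis_if_graver:
  assumes "finite M" "M \<subseteq> mat_kernel A" and M: "\<And>w. w \<in> graver A \<Longrightarrow> w \<in> M \<or> - w \<in> M"
  shows "markov_basis A M"
  unfolding markov_basis_def
proof (intro conjI allI impI)
  fix u v :: "int vec"
  let ?z = "0\<^sub>v (dim_col A) :: int vec"
  assume u: "u \<in> carrier_vec (dim_col A)" "?z \<le> u"
  assume "v \<in> carrier_vec (dim_col A)" "?z \<le> v" "A *\<^sub>v u = A *\<^sub>v v"
  then have "v - u \<in> mat_kernel A" "v \<in> carrier_vec (dim_col A)" "?z \<le> v"
    using u mat_kernel_diff_iff by auto
  then show "\<exists>L b s. (\<forall>j\<in>{1..L}. b j \<in> M \<and> s j \<in> {-1, 1}) \<and> walk u s b L = v \<and>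
           (\<forall>l\<in>{1..L}. ?z \<le> walk u s b l)"
  proof (induction "\<Sum>k<dim_col A. nat \<bar>(v - u) $ k\<bar>" arbitrary: v rule: less_induct)
    case less
    show ?case
    proof (cases "v - u = ?z")
      case True
      then have "(v - u) $ k = 0" if "k < dim_col A" for k using that by simp
      then have "v = u" using u less.prems by (intro eq_vecI) auto
      then show ?thesis
        by (intro exI[of _ 0] exI[of _ "\<lambda>_. u"] exI[of _ "\<lambda>_. 1"]) (simp add: walk_0)
    next
      case False
      then obtain w where w: "w \<in> graver A" "conformal w (v - u)"
        using ex_graver_conformal less.prems(1) by blast
      have wk: "w \<in> mat_kernel A" "w \<noteq> ?z" using w(1) by (auto simp: graver_def)
      have dims: "dim_vec w = dim_col A" "dim_vec v = dim_col A" "dim_vec u = dim_col A"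
        using wk u less.prems by (auto simp: mem_mat_kernel)
      have c: "between0 (w $ k) (v $ k - u $ k)" if "k < dim_col A" for k
        using w(2) that dims by (auto simp: conformal_def)
      have "u $ k \<ge> 0" "v $ k \<ge> 0" if "k < dim_col A" for k
        using u less.prems that by (auto simp: less_eq_vec_def)
      \<comment> \<open>In each coordinate \<open>v - w\<close> lies between \<open>u\<close> and
        \<open>v\<close>, so it inherits nonnegativity.\<close>
      with c have pos: "?z \<le> v - w" using dims
        by (fastforce simp: less_eq_vec_def between0_def)
      have "(v - w) - u = (v - u) - w" using dims by (intro eq_vecI) auto
      then have ker: "(v - w) - u \<in> mat_kernel A"
        using mat_kernel_linear(2)[OF less.prems(1) wk(1)] by simp
      have "conformal ((v - w) - u) (v - u)"
        using c dims by (fastforce simp: conformal_def between0_def)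
      moreover have "(v - w) - u \<noteq> v - u"
      proof
        assume eq: "(v - w) - u = v - u"
        have "w $ k = 0" if "k < dim_col A" for k
          using arg_cong[OF eq, of "\<lambda>x. x $ k"] dims that by simp
        then show False using wk(2) dims by (auto simp: vec_eq_iff)
      qed
      ultimately have less_norm: "(\<Sum>k<dim_col A. nat \<bar>((v - w) - u) $ k\<bar>) < (\<Sum>k<dim_col A. nat \<bar>(v - u) $ k\<bar>)"
        using conformal_norm_less[of "(v - w) - u" "v - u"] dims by simp
      have "v - w \<in> carrier_vec (dim_col A)" using dims by (intro carrier_vecI) simp
      from less.hyps[OF less_norm ker this pos] obtain L b s
        where Lbs: "\<forall>j\<in>{1..L}. b j \<in> M \<and> s j \<in> {-1, 1 :: int}" "walk u s b L = v - w"
          "\<forall>l\<in>{1..L}. ?z \<le> walk u s b l" by blast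
      obtain b0 and s0 :: int where b0: "b0 \<in> M" "s0 \<in> {-1, 1}"
          "\<And>k. k < dim_col A \<Longrightarrow> s0 * b0 $ k = w $ k"
      proof (cases "w \<in> M")
        case True
        then show ?thesis using that[of w 1] by auto
      next
        case False
        then have "- w \<in> M" using M[OF w(1)] by auto
        then show ?thesis using that[of "- w" "-1"] dims by auto
      qed
      \<comment> \<open>Walks number their moves from 1, so the appended move has index
        \<open>Suc L\<close>.\<close>
      define b' where "b' = b(Suc L := b0)"
      define s' where "s' = s(Suc L := s0)"
      have old: "walk u s' b' l = walk u s b l" if "l \<le> L" for l
        using that by (intro walk_cong) (auto simp: b'_def s'_def)
      have new: "walk u s' b' (Suc L) = v"
        using dims old[of L] Lbs(2) b0(3)
        by (intro eq_vecI) (auto simp: walk_Suc_index dim_walk b'_def s'_def)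
      show ?thesis
      proof (intro exI conjI ballI)
        show "walk u s' b' (Suc L) = v" by (rule new)
      next
        fix l assume "l \<in> {1..Suc L}"
        then show "?z \<le> walk u s' b' l"
          using new old[of l] Lbs(3) less.prems by (cases "l = Suc L") auto
      next
        fix j assume "j \<in> {1..Suc L}"
        then show "b' j \<in> M" "s' j \<in> {-1, 1}"
          using Lbs(1) b0 by (auto simp: b'_def s'_def)
      qed
    qed
  qed
qed (use assms in auto)

text \<open>For an antisymmetric kernel the fiber of the positive part \<open>w\<^sup>+\<close> of a Graver element
  consists of \<open>w\<^sup>+\<close> and \<open>w\<^sup>-\<close> only, so a walk between them contains the step \<open>\<plusminus>w\<close>.\<close>

lemma graver_in_markov_basis:
  assumes M: "markov_basis A M" and n: "dim_col A = n + n"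
    and anti: "\<And>v k. v \<in> mat_kernel A \<Longrightarrow> k < n \<Longrightarrow> v $ (n + k) = - (v $ k)"
    and w: "w \<in> graver A"
  shows "w \<in> M \<or> - w \<in> M"
proof -
  let ?z = "0\<^sub>v (dim_col A) :: int vec"
  have wk: "w \<in> mat_kernel A" "w \<noteq> ?z" and
    wmin: "\<And>v. v \<in> mat_kernel A \<Longrightarrow> conformal v w \<Longrightarrow> v = ?z \<or> v = w"
    using w by (auto simp: graver_def)
  have dw: "dim_vec w = dim_col A" using wk by (simp add: mem_mat_kernel)
  define u where "u = vec (dim_col A) (\<lambda>k. max 0 (- (w $ k)))"
  define v where "v = vec (dim_col A) (\<lambda>k. max 0 (w $ k))"
  have vu: "v - u = w" using dw by (intro eq_vecI) (auto simp: u_def v_def)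
  have carr: "u \<in> carrier_vec (dim_col A)" "v \<in> carrier_vec (dim_col A)"
    by (simp_all add: u_def v_def)
  have neq: "u \<noteq> v" using vu wk(2) carr by auto
  have "?z \<le> u" "?z \<le> v" by (auto simp: less_eq_vec_def u_def v_def)
  moreover have "A *\<^sub>v u = A *\<^sub>v v" using mat_kernel_diff_iff[OF carr] vu wk(1) by simp
  ultimately obtain L b s where Lbs: "\<forall>j\<in>{1..L}. b j \<in> M \<and> s j \<in> {-1, 1 :: int}"
      "walk u s b L = v" "\<forall>l\<in>{1..L}. ?z \<le> walk u s b l"
    using M carr unfolding markov_basis_def by blast
  have Mk: "M \<subseteq> mat_kernel A" using M by (simp add: markov_basis_def)
  \<comment> \<open>Every position of the walk stays in the fiber of \<open>u\<close>.\<close>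
  have ker: "walk u s b l - u \<in> mat_kernel A" if "l \<le> L" for l
    using that
  proof (induction l)
    case 0
    have "walk u s b 0 - u = ?z" using carr by (intro eq_vecI) (auto simp: walk_0)
    then show ?case by (simp add: mem_mat_kernel)
  next
    case (Suc l)
    have b: "b (Suc l) \<in> mat_kernel A" "s (Suc l) = -1 \<or> s (Suc l) = 1" using Lbs(1) Mk Suc.prems by auto
    then have "dim_vec (b (Suc l)) = dim_col A" by (simp add: mem_mat_kernel)
    then have "walk u s b (Suc l) - u = (walk u s b l - u) - b (Suc l) \<or>
        walk u s b (Suc l) - u = (walk u s b l - u) + b (Suc l)"
      using b(2) carr by (auto simp: vec_eq_iff walk_Suc_index dim_walk)
    then show ?case using Suc mat_kernel_linear b(1) by (metis Suc_leD)
  qed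
  have two: "walk u s b l = u \<or> walk u s b l = v" if l: "l \<le> L" for l
  proof -
    define x where "x = walk u s b l"
    have dx: "dim_vec x = dim_col A" using carr by (simp add: x_def dim_walk)
    have xu: "x - u \<in> mat_kernel A" using ker[OF l] by (simp add: x_def)
    have "?z \<le> x" using Lbs(3) l \<open>?z \<le> u\<close> by (cases "l = 0") (auto simp: x_def walk_0)
    then have x0: "x $ k \<ge> 0" if "k < dim_col A" for k using that dx by (simp add: less_eq_vec_def)
    have xk: "x $ (n + k) - u $ (n + k) = - (x $ k - u $ k)" if "k < n" for k
      using anti[OF xu that] that n dx carr by simp
    have wa: "w $ (n + k) = - (w $ k)" if "k < n" for k
      using anti[OF wk(1) that] .
    \<comment> \<open>Nonnegativity of \<open>x\<close> at \<open>k\<close> and at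
      \<open>n + k\<close> gives the two bounds on \<open>x $ k - u $ k\<close>: by antisymmetry the
      second coordinate moves opposite to the first, and one of the two starts at 0, the other at
      the absolute value of \<open>w $ k\<close>.\<close>
    have half: "between0 (x $ k - u $ k) (w $ k)" "between0 (x $ (n + k) - u $ (n + k)) (w $ (n + k))"
      if "k < n" for k
      using x0[of k] x0[of "n + k"] xk[OF that] wa[OF that] that n
      by (auto simp: between0_def u_def max_def split: if_splits)
    have "between0 ((x - u) $ k) (w $ k)" if "k < dim_col A" for k
      using half(1)[of k] half(2)[of "k - n"] that n carr by (cases "k < n") auto
    then have "conformal (x - u) w" using dw carr by (auto simp: conformal_def)
    from wmin[OF xu this] have "x - u = ?z \<or> x - u = v - u" using vu by simp
    then show ?thesis
    proof
      assume eq: "x - u = ?z"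
      have "x $ k = u $ k" if "k < dim_col A" for k
        using arg_cong[OF eq, of "\<lambda>y. y $ k"] that dx carr by simp
      then show ?thesis using dx carr by (auto simp: x_def[symmetric] vec_eq_iff)
    next
      assume eq: "x - u = v - u"
      have "x $ k = v $ k" if "k < dim_col A" for k
        using arg_cong[OF eq, of "\<lambda>y. y $ k"] that dx carr by simp
      then show ?thesis using dx carr by (auto simp: x_def[symmetric] vec_eq_iff)
    qed
  qed
  \<comment> \<open>At the first arrival at \<open>v\<close> the preceding position can only be
    \<open>u\<close>, so the move made there is \<open>w\<close> up to sign.\<close>
  define l where "l = (LEAST l. walk u s b l = v)"
  have l: "walk u s b l = v" "l \<le> L" unfolding l_def
    using Lbs(2) by (auto intro: LeastI Least_le)
  have "l \<noteq> 0" using l(1) neq by (metis walk_0)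
  then obtain m where m: "l = Suc m" by (cases l) auto
  have "walk u s b m \<noteq> v" using not_less_Least[of m "\<lambda>l. walk u s b l = v"] m by (auto simp: l_def)
  then have um: "walk u s b m = u" using two[of m] l(2) m by auto
  have b: "b l \<in> M" "s l = -1 \<or> s l = 1" using Lbs(1) l(2) m by auto
  then have db: "dim_vec (b l) = dim_col A" using Mk by (auto simp: mem_mat_kernel)
  have "w $ k = s l * b l $ k" if "k < dim_col A" for k
    using walk_Suc_index[of k u s b m] l(1) um that carr
    unfolding vu[symmetric] m by auto
  then have "w = b l \<or> - w = b l" using b(2) db dw by (auto simp: vec_eq_iff)
  then show ?thesis using b(1) by auto
qed

text \<open>The premise \<open>contains\<close> is the property that antisymmetry of the kernel
  provides. Discarding the non-Graver elements, or one of two opposite elements, leaves a Markov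
  basis; minimality therefore forbids both kinds of excess.\<close>

lemma minimal_markov_basis_graver:
  assumes "minimal_markov_basis A M"
    and contains: "\<And>M' w. markov_basis A M' \<Longrightarrow> w \<in> graver A \<Longrightarrow> w \<in> M' \<or> - w \<in> M'"
  shows "M \<subseteq> graver A" "\<And>w. w \<in> graver A \<Longrightarrow> - w \<in> M \<longleftrightarrow> w \<notin> M"
proof -
  have M: "markov_basis A M" "\<And>M'. M' \<subset> M \<Longrightarrow> \<not> markov_basis A M'"
    using assms(1) by (auto simp: minimal_markov_basis_def)
  have fin: "finite M" "M \<subseteq> mat_kernel A" using M(1) by (auto simp: markov_basis_def)
  have "markov_basis A (M \<inter> graver A)"
    using fin contains[OF M(1)] uminus_graver by (intro markov_basis_if_graver) auto
  then show "M \<subseteq> graver A" using M(2)[of "M \<inter> graver A"] by auto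
  show "- w \<in> M \<longleftrightarrow> w \<notin> M" if w: "w \<in> graver A" for w
  proof -
    have False if both: "- w \<in> M" "w \<in> M"
    proof -
      have dw: "dim_vec w = dim_col A" "w \<noteq> 0\<^sub>v (dim_col A)" using w by (auto simp: graver_def mem_mat_kernel)
      \<comment> \<open>This ensures that \<open>- w\<close> survives the removal of
        \<open>w\<close>.\<close>
      have "- w \<noteq> w"
      proof
        assume eq: "- w = w"
        have "w $ k = 0" if "k < dim_col A" for k
          using arg_cong[OF eq, of "\<lambda>y. y $ k"] that dw(1) by simp
        then show False using dw by (auto simp: vec_eq_iff)
      qed
      have "x \<in> M - {w} \<or> - x \<in> M - {w}" if "x \<in> graver A" for x
        using contains[OF M(1) that] both \<open>- w \<noteq> w\<close> by (metis Diff_iff singletonD singletonI uminus_uminus_vec)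
      then have "markov_basis A (M - {w})"
        using fin by (intro markov_basis_if_graver) auto
      then show False using M(2)[of "M - {w}"] both by auto
    qed
    then show ?thesis using contains[OF M(1) w] by auto
  qed
qed

lemma minimal_markov_basis_unique:
  assumes "minimal_markov_basis A M" "minimal_markov_basis A M'"
    and contains: "\<And>M' w. markov_basis A M' \<Longrightarrow> w \<in> graver A \<Longrightarrow> w \<in> M' \<or> - w \<in> M'"
  shows "equal_up_to_signs M M'"
proof -
  note M = minimal_markov_basis_graver[OF assms(1) contains]
  note M' = minimal_markov_basis_graver[OF assms(2) contains]
  \<comment> \<open>Both bases pick exactly one sign from each pair of opposite Graver elements;
    \<open>f\<close> flips the sign where the choices differ.\<close>
  define f where "f b = (if b \<in> M' then b else - b)" for b
  have "f b \<in> M'" if "b \<in> M" for b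
    using M(1) M'(2) that by (auto simp: f_def)
  moreover have "\<exists>b\<in>M. b' = f b" if b': "b' \<in> M'" for b'
  proof (cases "b' \<in> M")
    case True
    then show ?thesis using b' by (intro bexI[of _ b']) (auto simp: f_def)
  next
    case False
    have "b' \<in> graver A" using M'(1) b' by auto
    then have "- b' \<in> M" "- b' \<notin> M'" using M(2) M'(2) b' False by auto
    then show ?thesis by (intro bexI[of _ "- b'"]) (auto simp: f_def)
  qed
  ultimately have "M' = f ` M" by blast
  then show ?thesis unfolding equal_up_to_signs_def
    by (intro exI[of _ f]) (auto simp: f_def)
qed

text \<open>The Graver basis is a finite Markov basis, so some Markov basis is inclusion-minimal
  among its subsets; any Markov basis properly inside that one would again be such a subset.\<close>

lemma ex_minimal_markov_basis: "\<exists>M. minimal_markov_basis A M"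
proof -
  let ?F = "{M. M \<subseteq> graver A \<and> markov_basis A M}"
  have "graver A \<in> ?F"
    using finite_graver by (auto intro!: markov_basis_if_graver simp: graver_def)
  moreover have "finite ?F" using finite_graver by simp
  ultimately obtain M where "M \<in> ?F" "\<forall>M'\<in>?F. M' \<subseteq> M \<longrightarrow> M = M'"
    using finite_has_minimal[of ?F] by blast
  then show ?thesis unfolding minimal_markov_basis_def
    by (intro exI[of _ M]) blast
qed

section \<open>Kernels and Graver elements of Lawrence liftings\<close>

lemma mat_kernel_lawrence_lifting:
  "mat_kernel (lawrence_lifting A) = (\<lambda>v. v @\<^sub>v - v) ` mat_kernel A"
proof -
  let ?n = "dim_col A"
  have mult: "lawrence_lifting A *\<^sub>v (a @\<^sub>v d) = (A *\<^sub>v a) @\<^sub>v (a + d)"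
    if "a \<in> carrier_vec ?n" "d \<in> carrier_vec ?n" for a d
  proof -
    have "lawrence_lifting A *\<^sub>v (a @\<^sub>v d) =
        (A *\<^sub>v a + 0\<^sub>m (dim_row A) ?n *\<^sub>v d) @\<^sub>v (1\<^sub>m ?n *\<^sub>v a + 1\<^sub>m ?n *\<^sub>v d)"
      unfolding lawrence_lifting_def using that
      by (intro four_block_mat_mult_vec[of _ "dim_row A" ?n _ ?n _ ?n]) auto
    also have "A *\<^sub>v a + 0\<^sub>m (dim_row A) ?n *\<^sub>v d = A *\<^sub>v a"
      using that by (intro eq_vecI) (auto simp: scalar_prod_def)
    also have "1\<^sub>m ?n *\<^sub>v a + 1\<^sub>m ?n *\<^sub>v d = a + d" using that by simp
    finally show ?thesis .
  qed
  have dims: "dim_col (lawrence_lifting A) = ?n + ?n" "dim_row (lawrence_lifting A) = dim_row A + ?n"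
    by (auto simp: lawrence_lifting_def)
  have zero: "0\<^sub>v (dim_row A + ?n) = 0\<^sub>v (dim_row A) @\<^sub>v 0\<^sub>v ?n" by auto
  have iff: "a @\<^sub>v d \<in> mat_kernel (lawrence_lifting A) \<longleftrightarrow> a \<in> mat_kernel A \<and> d = - a"
    if "a \<in> carrier_vec ?n" "d \<in> carrier_vec ?n" for a d
  proof -
    have "a + d = 0\<^sub>v ?n \<longleftrightarrow> d = - a" using that
      by (auto simp: vec_eq_iff add_eq_0_iff)
    moreover have "a @\<^sub>v d \<in> mat_kernel (lawrence_lifting A) \<longleftrightarrow>
        (A *\<^sub>v a) @\<^sub>v (a + d) = 0\<^sub>v (dim_row A) @\<^sub>v 0\<^sub>v ?n"
      using that by (simp add: mat_kernel_def dims mult zero)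
    moreover have "\<dots> \<longleftrightarrow> A *\<^sub>v a = 0\<^sub>v (dim_row A) \<and> a + d = 0\<^sub>v ?n"
    proof (rule append_vec_eq)
      show "A *\<^sub>v a \<in> carrier_vec (dim_row A)" by (rule carrier_vecI) simp
    qed (rule zero_carrier_vec)
    ultimately show ?thesis using that by (simp add: mat_kernel_def)
  qed
  show ?thesis
  proof (intro equalityI subsetI)
    fix w assume w: "w \<in> mat_kernel (lawrence_lifting A)"
    then have c: "w \<in> carrier_vec (?n + ?n)" by (simp add: mat_kernel_def dims)
    define a d where "a = vec_first w ?n" and "d = vec_last w ?n"
    have "w = a @\<^sub>v d" using vec_first_last_append[OF c] by (simp add: a_def d_def)
    moreover have "a \<in> carrier_vec ?n" "d \<in> carrier_vec ?n" by (simp_all add: a_def d_def)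
    ultimately have "w = a @\<^sub>v - a" "a \<in> mat_kernel A" using iff[of a d] w by metis+
    then show "w \<in> (\<lambda>v. v @\<^sub>v - v) ` mat_kernel A" by (rule image_eqI)
  next
    fix w assume "w \<in> (\<lambda>v. v @\<^sub>v - v) ` mat_kernel A"
    then obtain v where v: "v \<in> mat_kernel A" "w = v @\<^sub>v - v" by blast
    then have "v \<in> carrier_vec ?n" by (simp add: mat_kernel_def)
    then show "w \<in> mat_kernel (lawrence_lifting A)" using iff[of v "- v"] v by simp
  qed
qed

lemma graver_in_markov_basis_lawrence_lifting:
  assumes "markov_basis (lawrence_lifting A) M" "w \<in> graver (lawrence_lifting A)"
  shows "w \<in> M \<or> - w \<in> M"
proof (rule graver_in_markov_basis[OF assms(1) _ _ assms(2)])
  show "dim_col (lawrence_lifting A) = dim_col A + dim_col A"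
    by (simp add: lawrence_lifting_def)
  show "v $ (dim_col A + k) = - (v $ k)"
    if "v \<in> mat_kernel (lawrence_lifting A)" "k < dim_col A" for v k
    using that by (auto simp: mat_kernel_lawrence_lifting mem_mat_kernel)
qed

text \<open>Kernel vectors of the lifting are determined by their first half, and conformality of
  the lifted vectors restricts to that half, so minimality carries over.\<close>

lemma graver_lawrence_lifting:
  assumes g: "g \<in> graver A"
  shows "g @\<^sub>v - g \<in> graver (lawrence_lifting A)"
proof -
  let ?n = "dim_col A"
  have gk: "g \<in> mat_kernel A" "g \<noteq> 0\<^sub>v ?n"
    and gmin: "\<And>v. v \<in> mat_kernel A \<Longrightarrow> conformal v g \<Longrightarrow> v = 0\<^sub>v ?n \<or> v = g"
    using g by (auto simp: graver_def)
  have c: "g \<in> carrier_vec ?n" using gk by (simp add: mat_kernel_def)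
  have dims: "dim_col (lawrence_lifting A) = ?n + ?n" by (simp add: lawrence_lifting_def)
  have zero: "0\<^sub>v (?n + ?n) = 0\<^sub>v ?n @\<^sub>v (0\<^sub>v ?n :: int vec)" by auto
  have "g @\<^sub>v - g \<noteq> 0\<^sub>v (?n + ?n)"
    unfolding zero using gk(2) c by (simp add: append_vec_eq[of _ ?n])
  moreover have "w = 0\<^sub>v (?n + ?n) \<or> w = g @\<^sub>v - g"
    if w: "w \<in> mat_kernel (lawrence_lifting A)" "conformal w (g @\<^sub>v - g)" for w
  proof -
    obtain v where v: "v \<in> mat_kernel A" "w = v @\<^sub>v - v"
      using w(1) by (auto simp: mat_kernel_lawrence_lifting)
    have dv: "dim_vec v = ?n" using v by (simp add: mem_mat_kernel)
    have "between0 (v $ k) (g $ k)" if "k < ?n" for k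
      using w(2) c dv that unfolding v(2) conformal_def
      by (auto dest!: spec[of _ k])
    then have "conformal v g" using c dv by (auto simp: conformal_def)
    from gmin[OF v(1) this] show ?thesis unfolding v(2) zero by auto
  qed
  ultimately show ?thesis
    using gk(1) by (auto simp: graver_def mat_kernel_lawrence_lifting dims)
qed

text \<open>An entry and its negative together contribute their common absolute value to the sum of
  positive entries.\<close>

lemma move_degree_append_uminus:
  "move_degree (v @\<^sub>v - v) = (\<Sum>k<dim_vec v. \<bar>v $ k\<bar>)"
proof -
  let ?n = "dim_vec v"
  let ?w = "v @\<^sub>v - v"
  have "move_degree ?w = (\<Sum>i<?n + ?n. max 0 (?w $ i))"
    unfolding move_degree_def by (intro sum.mono_neutral_cong_left) auto
  also have "\<dots> = (\<Sum>i<?n. max 0 (?w $ i)) + (\<Sum>i<?n. max 0 (?w $ (i + ?n)))"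
    using sum.atLeastLessThan_concat[of 0 ?n "?n + ?n" "\<lambda>i. max 0 (?w $ i)"]
      sum.shift_bounds_nat_ivl[of "\<lambda>i. max 0 (?w $ i)" 0 ?n ?n]
    by (simp add: lessThan_atLeast0)
  also have "\<dots> = (\<Sum>k<?n. \<bar>v $ k\<bar>)"
    unfolding sum.distrib[symmetric] by (intro sum.cong) auto
  finally show ?thesis .
qed

lemma uminus_append_vec: "- (u @\<^sub>v v) = - u @\<^sub>v - v"
  by (intro eq_vecI) auto

subsection \<open>The kernel of \<open>B_mat\<close>\<close>

lemma distinct_col_pairs: "distinct (col_pairs \<Delta>)"
proof -
  have "distinct (concat (map (\<lambda>i. map (Pair i) [i..<Suc \<Delta>]) xs))" if "distinct xs" for xs
    using that by (induction xs) (auto simp: distinct_map inj_on_def simp del: upt_Suc)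
  then show ?thesis by (simp add: col_pairs_def del: upt_Suc)
qed

lemma sum_col_pairs:
  "(\<Sum>c<Suc \<Delta> choose 2. h (col_pairs \<Delta> ! c)) = (\<Sum>e\<in>set (col_pairs \<Delta>). h e)"
  using sum.reindex_bij_betw[OF bij_betw_nth[OF distinct_col_pairs refl refl], of h \<Delta>]
  by (simp add: length_col_pairs)

text \<open>Lets kernel vectors be handled as functions on index pairs, without column
  numbers.\<close>

definition pair_vec :: "nat \<Rightarrow> (nat \<times> nat \<Rightarrow> int) \<Rightarrow> int vec" where
  "pair_vec \<Delta> D = vec (Suc \<Delta> choose 2) (\<lambda>c. D (col_pairs \<Delta> ! c))"

lemma dim_pair_vec [simp]: "dim_vec (pair_vec \<Delta> D) = Suc \<Delta> choose 2"
  by (simp add: pair_vec_def)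

lemma ex_pair_vec:
  assumes "dim_vec v = Suc \<Delta> choose 2"
  shows "\<exists>D. v = pair_vec \<Delta> D"
proof -
  let ?f = "the_inv_into {..<Suc \<Delta> choose 2} ((!) (col_pairs \<Delta>))"
  have "inj_on ((!) (col_pairs \<Delta>)) {..<Suc \<Delta> choose 2}"
    using distinct_col_pairs by (auto intro!: inj_on_nth simp: length_col_pairs)
  then have "?f (col_pairs \<Delta> ! c) = c" if "c < Suc \<Delta> choose 2" for c
    using that by (intro the_inv_into_f_f) auto
  then have "v = pair_vec \<Delta> (\<lambda>e. v $ ?f e)"
    using assms by (intro eq_vecI) (auto simp: pair_vec_def)
  then show ?thesis by (intro exI[of _ "\<lambda>e. v $ ?f e"])
qed

lemma pair_vec_all_iff:
  "(\<forall>c<Suc \<Delta> choose 2. Q (pair_vec \<Delta> D $ c) (pair_vec \<Delta> E $ c)) \<longleftrightarrow>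
     (\<forall>e\<in>set (col_pairs \<Delta>). Q (D e) (E e))"
  by (simp add: pair_vec_def all_set_conv_all_nth length_col_pairs)

lemma sum_abs_pair_vec:
  "(\<Sum>c<Suc \<Delta> choose 2. \<bar>pair_vec \<Delta> D $ c\<bar>) = (\<Sum>e\<in>set (col_pairs \<Delta>). \<bar>D e\<bar>)"
  unfolding sum_col_pairs[symmetric] by (intro sum.cong) (auto simp: pair_vec_def)

lemma pair_vec_mem_mat_kernel_rows:
  "pair_vec \<Delta> D \<in> mat_kernel (B_mat \<Delta>) \<longleftrightarrow>
     (\<forall>r<3 * \<Delta> - 1. (\<Sum>e\<in>set (col_pairs \<Delta>). B_entry \<Delta> (Suc r) e * D e) = 0)"
  unfolding mem_mat_kernel sum_col_pairs[symmetric]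
  by (simp add: B_mat_def pair_vec_def)

text \<open>The row equations in dual form: arbitrary test functions on vertices and on
  antidiagonals stand for linear combinations of rows, so later proofs can choose convenient ones.
  Indicator functions give back the single rows.\<close>

lemma pair_vec_mem_mat_kernel:
  assumes "\<Delta> \<ge> 1"
  shows "pair_vec \<Delta> D \<in> mat_kernel (B_mat \<Delta>) \<longleftrightarrow>
     (\<forall>f. (\<Sum>e\<in>set (col_pairs \<Delta>). (f (fst e) + f (snd e)) * D e) = 0) \<and>
     (\<forall>h. (\<Sum>e\<in>set (col_pairs \<Delta>). h (fst e + snd e) * D e) = 0)"
    (is "?K \<longleftrightarrow> (\<forall>f. ?V f = 0) \<and> (\<forall>h. ?H h = 0)")
proof
  assume ?K
  then have row: "(\<Sum>e\<in>set (col_pairs \<Delta>). B_entry \<Delta> r e * D e) = 0" if "1 \<le> r" "r \<le> 3 * \<Delta> - 1" for r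
    using that by (cases r) (auto simp: pair_vec_mem_mat_kernel_rows)
  have "?V f = 0" for f
  proof -
    \<comment> \<open>The entry 2 in row \<open>r\<close> of the column \<open>(r, r)\<close>
      accounts for a loop counting its vertex twice.\<close>
    have "f (fst e) + f (snd e) = (\<Sum>r\<in>{1..\<Delta>}. f r * B_entry \<Delta> r e)" if "e \<in> set (col_pairs \<Delta>)" for e
    proof -
      have "(\<Sum>r\<in>{1..\<Delta>}. f r * B_entry \<Delta> r e) =
          (\<Sum>r\<in>{1..\<Delta>}. (if fst e = r then f r else 0) + (if snd e = r then f r else 0))"
        by (intro sum.cong) (auto simp: B_entry_def split_beta)
      also have "\<dots> = f (fst e) + f (snd e)"
        using that by (auto simp: sum.distrib set_col_pairs)
      finally show ?thesis by simp
    qed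
    then have "?V f = (\<Sum>e\<in>set (col_pairs \<Delta>). \<Sum>r\<in>{1..\<Delta>}. f r * (B_entry \<Delta> r e * D e))"
      by (intro sum.cong) (simp_all add: sum_distrib_right mult.assoc)
    also have "\<dots> = (\<Sum>r\<in>{1..\<Delta>}. f r * (\<Sum>e\<in>set (col_pairs \<Delta>). B_entry \<Delta> r e * D e))"
      by (subst sum.swap) (simp add: sum_distrib_left)
    also have "\<dots> = 0"
    proof (rule sum.neutral, rule ballI)
      fix r assume r: "r \<in> {1..\<Delta>}"
      then have "r \<le> 3 * \<Delta> - 1" by auto
      with r show "f r * (\<Sum>e\<in>set (col_pairs \<Delta>). B_entry \<Delta> r e * D e) = 0" using row[of r] by simp
    qed
    finally show ?thesis .
  qed
  moreover have "?H h = 0" for h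
  proof -
    \<comment> \<open>Index sums of labels lie in \<open>{2..2 * \<Delta>}\<close>, so each column
      meets exactly one antidiagonal row.\<close>
    have "h (fst e + snd e) = (\<Sum>\<kappa>\<in>{2..2 * \<Delta>}. h \<kappa> * B_entry \<Delta> (\<kappa> + \<Delta> - 1) e)"
      if "e \<in> set (col_pairs \<Delta>)" for e
    proof -
      have "(\<Sum>\<kappa>\<in>{2..2 * \<Delta>}. h \<kappa> * B_entry \<Delta> (\<kappa> + \<Delta> - 1) e) =
          (\<Sum>\<kappa>\<in>{2..2 * \<Delta>}. if fst e + snd e = \<kappa> then h \<kappa> else 0)"
        by (intro sum.cong) (auto simp: B_entry_def split_beta)
      also have "\<dots> = h (fst e + snd e)"
        using that by (auto simp: set_col_pairs)
      finally show ?thesis by simp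
    qed
    then have "?H h = (\<Sum>e\<in>set (col_pairs \<Delta>). \<Sum>\<kappa>\<in>{2..2 * \<Delta>}. h \<kappa> * (B_entry \<Delta> (\<kappa> + \<Delta> - 1) e * D e))"
      by (intro sum.cong) (simp_all add: sum_distrib_right mult.assoc)
    also have "\<dots> = (\<Sum>\<kappa>\<in>{2..2 * \<Delta>}. h \<kappa> * (\<Sum>e\<in>set (col_pairs \<Delta>). B_entry \<Delta> (\<kappa> + \<Delta> - 1) e * D e))"
      by (subst sum.swap) (simp add: sum_distrib_left)
    also have "\<dots> = 0"
    proof (rule sum.neutral, rule ballI)
      fix \<kappa> assume "\<kappa> \<in> {2..2 * \<Delta>}"
      then have "1 \<le> \<kappa> + \<Delta> - 1" "\<kappa> + \<Delta> - 1 \<le> 3 * \<Delta> - 1" by auto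
      then show "h \<kappa> * (\<Sum>e\<in>set (col_pairs \<Delta>). B_entry \<Delta> (\<kappa> + \<Delta> - 1) e * D e) = 0"
        using row[of "\<kappa> + \<Delta> - 1"] by simp
    qed
    finally show ?thesis .
  qed
  ultimately show "(\<forall>f. ?V f = 0) \<and> (\<forall>h. ?H h = 0)" by blast
next
  assume R: "(\<forall>f. ?V f = 0) \<and> (\<forall>h. ?H h = 0)"
  have "(\<Sum>e\<in>set (col_pairs \<Delta>). B_entry \<Delta> r e * D e) = 0" for r
  proof (cases "r \<le> \<Delta>")
    case True
    then have "B_entry \<Delta> r e = of_bool (fst e = r) + of_bool (snd e = r)" for e
      by (auto simp: B_entry_def split_beta)
    then show ?thesis using R[THEN conjunct1, rule_format, of "\<lambda>v. of_bool (v = r)"] by simp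
  next
    case False
    then have "B_entry \<Delta> r e = of_bool (fst e + snd e + \<Delta> = r + 1)" for e
      by (auto simp: B_entry_def split_beta)
    then show ?thesis
      using R[THEN conjunct2, rule_format, of "\<lambda>\<kappa>. of_bool (\<kappa> + \<Delta> = r + 1)"] by simp
  qed
  then show ?K by (simp add: pair_vec_mem_mat_kernel_rows)
qed

subsection \<open>A Graver element of large norm\<close>

text \<open>The column \<open>{3, 2k+2}\<close>, with its two indices in increasing order.\<close>

definition mid_pair :: "nat \<Rightarrow> nat \<times> nat" where
  "mid_pair k = (if k = 0 then (2, 3) else (3, 2 * k + 2))"

definition move_supp :: "nat \<Rightarrow> (nat \<times> nat) set" where
  "move_supp k =
     (\<lambda>i. (2 * i + 3, 2 * i + 3)) ` {..<k} \<union> (\<lambda>i. (2 * i + 1, 2 * i + 5)) ` {..<k} \<union>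
     (\<lambda>i. (2 * i + 4, 2 * i + 4)) ` {..<k} \<union> (\<lambda>i. (2 * i + 2, 2 * i + 6)) ` {..<k} \<union>
     {(2, 2), (1, 3), (2 * k + 3, 2 * k + 3), (2 * k + 2, 2 * k + 4), (1, 2 * k + 4), mid_pair k}"

lemma move_supp_subset: "2 * k + 4 \<le> \<Delta> \<Longrightarrow> move_supp k \<subseteq> set (col_pairs \<Delta>)"
  by (auto simp: move_supp_def set_col_pairs mid_pair_def)

text \<open>The listed columns are distinct, and each bracket collects the two on one
  antidiagonal.\<close>

lemma sum_move_supp:
  fixes h :: "nat \<times> nat \<Rightarrow> int"
  shows "(\<Sum>e\<in>move_supp k. h e) =
     (\<Sum>i<k. h (2 * i + 3, 2 * i + 3) + h (2 * i + 1, 2 * i + 5)) +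
     (\<Sum>i<k. h (2 * i + 4, 2 * i + 4) + h (2 * i + 2, 2 * i + 6)) +
     (h (2, 2) + h (1, 3)) + (h (2 * k + 3, 2 * k + 3) + h (2 * k + 2, 2 * k + 4)) +
     (h (1, 2 * k + 4) + h (mid_pair k))"
proof -
  let ?a = "\<lambda>i::nat. (2 * i + 3, 2 * i + 3)" and ?b = "\<lambda>i::nat. (2 * i + 1, 2 * i + 5)"
  let ?c = "\<lambda>i::nat. (2 * i + 4, 2 * i + 4)" and ?d = "\<lambda>i::nat. (2 * i + 2, 2 * i + 6)"
  let ?I = "{..<k}"
  let ?E = "{(2, 2), (1, 3), (2 * k + 3, 2 * k + 3), (2 * k + 2, 2 * k + 4), (1, 2 * k + 4), mid_pair k}"
  have parity: "2 * i \<noteq> Suc (2 * j)" "Suc (2 * i) \<noteq> 2 * j" for i j :: nat by presburger+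
  \<comment> \<open>The families consist of loops and of pairs with difference 4. The six
    exceptional columns are loops outside the index range, pairs with difference 2, or pairs of
    mixed parity.\<close>
  have disj: "(?a ` ?I \<union> ?b ` ?I \<union> ?c ` ?I \<union> ?d ` ?I) \<inter> ?E = {}"
    "(?a ` ?I \<union> ?b ` ?I \<union> ?c ` ?I) \<inter> ?d ` ?I = {}" "(?a ` ?I \<union> ?b ` ?I) \<inter> ?c ` ?I = {}"
    "?a ` ?I \<inter> ?b ` ?I = {}"
    by (auto simp: mid_pair_def split: if_splits) presburger+
  have E: "sum h ?E = h (2, 2) + (h (1, 3) + (h (2 * k + 3, 2 * k + 3) + (h (2 * k + 2, 2 * k + 4) +
      (h (1, 2 * k + 4) + h (mid_pair k)))))"
    by (cases "k = 0") (auto simp: mid_pair_def)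
  have inj: "inj_on ?a ?I" "inj_on ?b ?I" "inj_on ?c ?I" "inj_on ?d ?I" by (auto simp: inj_on_def)
  have "(\<Sum>e\<in>move_supp k. h e) = sum h (?a ` ?I) + sum h (?b ` ?I) + sum h (?c ` ?I) + sum h (?d ` ?I) + sum h ?E"
    unfolding move_supp_def using disj by (simp add: sum.union_disjoint del: Un_insert_right)
  also have "\<dots> = (\<Sum>i<k. h (?a i)) + (\<Sum>i<k. h (?b i)) + (\<Sum>i<k. h (?c i)) + (\<Sum>i<k. h (?d i)) + sum h ?E"
    using inj by (simp add: sum.reindex)
  finally show ?thesis unfolding E by (simp add: sum.distrib)
qed

lemma sum_col_pairs_move_supp:
  fixes h :: "nat \<times> nat \<Rightarrow> int"
  assumes "2 * k + 4 \<le> \<Delta>" "\<And>e. e \<in> set (col_pairs \<Delta>) \<Longrightarrow> e \<notin> move_supp k \<Longrightarrow> h e = 0"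
  shows "(\<Sum>e\<in>set (col_pairs \<Delta>). h e) = (\<Sum>e\<in>move_supp k. h e)"
  using move_supp_subset[OF assms(1)] assms(2) by (intro sum.mono_neutral_right) auto

lemma sum_diagonals_move_supp:
  fixes h :: "nat \<Rightarrow> int"
  shows "(\<Sum>e\<in>move_supp k. h (fst e + snd e) * D e) =
     (\<Sum>i<k. h (4 * i + 6) * (D (2 * i + 3, 2 * i + 3) + D (2 * i + 1, 2 * i + 5))) +
     (\<Sum>i<k. h (4 * i + 8) * (D (2 * i + 4, 2 * i + 4) + D (2 * i + 2, 2 * i + 6))) +
     h 4 * (D (2, 2) + D (1, 3)) + h (4 * k + 6) * (D (2 * k + 3, 2 * k + 3) + D (2 * k + 2, 2 * k + 4)) +
     h (2 * k + 5) * (D (1, 2 * k + 4) + D (mid_pair k))"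
proof -
  have "fst (mid_pair k) + snd (mid_pair k) = 2 * k + 5" by (simp add: mid_pair_def)
  moreover have "(2 * i + 3) + (2 * i + 3) = 4 * i + 6" "(2 * i + 1) + (2 * i + 5) = 4 * i + 6"
    "(2 * i + 4) + (2 * i + 4) = 4 * i + 8" "(2 * i + 2) + (2 * i + 6) = 4 * i + 8"
    "(2 * i + 2) + (2 * i + 4) = 4 * i + 6" "1 + (2 * i + 4) = 2 * i + 5" "2 + 2 = (4::nat)" "1 + 3 = (4::nat)"
    for i :: nat by simp_all
  ultimately show ?thesis
    unfolding sum_move_supp fst_conv snd_conv by (simp only: distrib_left)
qed

text \<open>Once the two entries on each antidiagonal are opposite, one free coefficient per
  antidiagonal remains. Splitting the test function into \<open>F\<close> on even and
  \<open>H\<close> on odd vertices turns the two families into second differences.\<close>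

lemma sum_vertices_move_supp:
  fixes F H :: "nat \<Rightarrow> int"
  defines "f \<equiv> \<lambda>v. if even v then F (v div 2) else H (v div 2)"
  assumes "\<And>i. i < k \<Longrightarrow> D (2 * i + 1, 2 * i + 5) = - D (2 * i + 3, 2 * i + 3)"
    and "\<And>i. i < k \<Longrightarrow> D (2 * i + 2, 2 * i + 6) = - D (2 * i + 4, 2 * i + 4)"
    and "D (1, 3) = - D (2, 2)" "D (2 * k + 2, 2 * k + 4) = - D (2 * k + 3, 2 * k + 3)"
    and "D (mid_pair k) = - D (1, 2 * k + 4)"
  shows "(\<Sum>e\<in>move_supp k. (f (fst e) + f (snd e)) * D e) =
     (\<Sum>i<k. D (2 * i + 3, 2 * i + 3) * (2 * H (i + 1) - H i - H (i + 2))) +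
     (\<Sum>i<k. D (2 * i + 4, 2 * i + 4) * (2 * F (i + 2) - F (i + 1) - F (i + 3))) +
     D (2, 2) * (2 * F 1 - H 0 - H 1) +
     D (2 * k + 3, 2 * k + 3) * (2 * H (k + 1) - F (k + 1) - F (k + 2)) +
     D (1, 2 * k + 4) * (H 0 + F (k + 2) - H 1 - F (k + 1))"
proof -
  have f: "f (2 * i + 1) = H i" "f (2 * i + 3) = H (i + 1)" "f (2 * i + 5) = H (i + 2)"
    "f (2 * i + 2) = F (i + 1)" "f (2 * i + 4) = F (i + 2)" "f (2 * i + 6) = F (i + 3)" for i
  proof -
    have "(2 * i + 1) div 2 = i" "(2 * i + 3) div 2 = i + 1" "(2 * i + 5) div 2 = i + 2"
      "(2 * i + 2) div 2 = i + 1" "(2 * i + 4) div 2 = i + 2" "(2 * i + 6) div 2 = i + 3" by presburger+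
    then show "f (2 * i + 1) = H i" "f (2 * i + 3) = H (i + 1)" "f (2 * i + 5) = H (i + 2)"
      "f (2 * i + 2) = F (i + 1)" "f (2 * i + 4) = F (i + 2)" "f (2 * i + 6) = F (i + 3)"
      unfolding f_def by simp_all
  qed
  have f0: "f 1 = H 0" "f 2 = F 1" "f 3 = H 1" by (simp_all add: f_def)
  have mid: "f (fst (mid_pair k)) + f (snd (mid_pair k)) = H 1 + F (k + 1)"
    using f(4)[of k] by (simp add: mid_pair_def f0)
  show ?thesis
    unfolding sum_move_supp fst_conv snd_conv mid f f0 assms(4-6)
  proof (intro arg_cong2[of _ _ _ _ "(+)"])
    show "(\<Sum>i<k. (H (i + 1) + H (i + 1)) * D (2 * i + 3, 2 * i + 3) + (H i + H (i + 2)) * D (2 * i + 1, 2 * i + 5)) =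
        (\<Sum>i<k. D (2 * i + 3, 2 * i + 3) * (2 * H (i + 1) - H i - H (i + 2)))"
      using assms(2) by (intro sum.cong) (simp_all add: algebra_simps)
    show "(\<Sum>i<k. (F (i + 2) + F (i + 2)) * D (2 * i + 4, 2 * i + 4) + (F (i + 1) + F (i + 3)) * D (2 * i + 2, 2 * i + 6)) =
        (\<Sum>i<k. D (2 * i + 4, 2 * i + 4) * (2 * F (i + 2) - F (i + 1) - F (i + 3)))"
      using assms(3) by (intro sum.cong) (simp_all add: algebra_simps)
  qed (simp_all add: algebra_simps)
qed

lemma move_supp_cases:
  assumes "e \<in> move_supp k"
  obtains (odd) i where "i < k" "e = (2 * i + 3, 2 * i + 3) \<or> e = (2 * i + 1, 2 * i + 5)"
  | (even) i where "i < k" "e = (2 * i + 4, 2 * i + 4) \<or> e = (2 * i + 2, 2 * i + 6)"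
  | (low) "e = (2, 2) \<or> e = (1, 3)"
  | (high) "e = (2 * k + 3, 2 * k + 3) \<or> e = (2 * k + 2, 2 * k + 4)"
  | (mid) "e = (1, 2 * k + 4) \<or> e = mid_pair k"
  using assms unfolding move_supp_def by blast

text \<open>The coefficient of the loop \<open>(c, c)\<close>, whose partner on the antidiagonal
  \<open>2 * c\<close> gets the negative. The linear formulas would give 0 at the ends
  \<open>c = 2\<close> and \<open>c = 2 * k + 3\<close>, where the value is 1.\<close>

definition move_weight :: "nat \<Rightarrow> nat \<Rightarrow> int" where
  "move_weight k c =
     (if c = 2 \<or> c = 2 * k + 3 then 1 else if odd c then 2 * int k + 3 - int c else int c - 2)"

text \<open>The two columns of odd index sum \<open>2 * k + 5\<close> are treated first; on the
  others in the support, halving the index sum recovers the loop of the antidiagonal.\<close>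

definition move :: "nat \<Rightarrow> nat \<times> nat \<Rightarrow> int" where
  "move k e =
     (if e \<notin> move_supp k then 0
      else if e = (1, 2 * k + 4) then 2 * int k + 1
      else if e = mid_pair k then - (2 * int k + 1)
      else if fst e = snd e then move_weight k (fst e)
      else - move_weight k ((fst e + snd e) div 2))"

lemma move_simps:
  "i < k \<Longrightarrow> move k (2 * i + 3, 2 * i + 3) = 2 * int (k - i)"
  "i < k \<Longrightarrow> move k (2 * i + 1, 2 * i + 5) = - (2 * int (k - i))"
  "i < k \<Longrightarrow> move k (2 * i + 4, 2 * i + 4) = 2 * int (i + 1)"
  "i < k \<Longrightarrow> move k (2 * i + 2, 2 * i + 6) = - (2 * int (i + 1))"
  "move k (2, 2) = 1" "move k (1, 3) = -1"
  "move k (2 * k + 3, 2 * k + 3) = 1" "move k (2 * k + 2, 2 * k + 4) = -1"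
  "move k (1, 2 * k + 4) = 2 * int k + 1" "move k (mid_pair k) = - (2 * int k + 1)"
proof -
  have half: "(2 * i + 1 + (2 * i + 5)) div 2 = 2 * i + 3" "(2 * i + 2 + (2 * i + 6)) div 2 = 2 * i + 4"
    "(2 * i + 2 + (2 * i + 4)) div 2 = 2 * i + 3" for i :: nat by presburger+
  have S: "i < k \<Longrightarrow> (2 * i + 3, 2 * i + 3) \<in> move_supp k" "i < k \<Longrightarrow> (2 * i + 1, 2 * i + 5) \<in> move_supp k"
    "i < k \<Longrightarrow> (2 * i + 4, 2 * i + 4) \<in> move_supp k" "i < k \<Longrightarrow> (2 * i + 2, 2 * i + 6) \<in> move_supp k"
    "(2, 2) \<in> move_supp k" "(1, 3) \<in> move_supp k" "(2 * k + 3, 2 * k + 3) \<in> move_supp k"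
    "(2 * k + 2, 2 * k + 4) \<in> move_supp k" "(1, 2 * k + 4) \<in> move_supp k" "mid_pair k \<in> move_supp k"
    for i unfolding move_supp_def by blast+
  have wt: "i < k \<Longrightarrow> move_weight k (2 * i + 3) = 2 * int (k - i)" "move_weight k (2 * i + 4) = 2 * int (i + 1)"
    "move_weight k (2 * k + 3) = 1" "move_weight k 2 = 1" for i
    by (auto simp: move_weight_def of_nat_diff) presburger+
  show "move k (2 * i + 3, 2 * i + 3) = 2 * int (k - i)" if "i < k"
    using S(1)[OF that] wt(1)[OF that] that by (simp add: move_def mid_pair_def)
  have "2 * i + 5 \<noteq> 2 * k + 4" "2 * i + 5 \<noteq> 2 * k + 2" by presburger+
  then show "move k (2 * i + 1, 2 * i + 5) = - (2 * int (k - i))" if "i < k"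
    using S(2)[OF that] wt(1)[OF that] that unfolding move_def fst_conv snd_conv half
    by (simp add: mid_pair_def)
  show "move k (2 * i + 4, 2 * i + 4) = 2 * int (i + 1)" if "i < k"
    using S(3)[OF that] wt(2)[of i] that by (simp add: move_def mid_pair_def)
  have "2 * i + 2 \<noteq> 3" by presburger
  then show "move k (2 * i + 2, 2 * i + 6) = - (2 * int (i + 1))" if "i < k"
    using S(4)[OF that] wt(2)[of i] that unfolding move_def fst_conv snd_conv half
    by (simp add: mid_pair_def)
  show "move k (2, 2) = 1" using S(5) wt(4) by (simp add: move_def mid_pair_def)
  show "move k (1, 3) = -1" using S(6) wt(4) by (simp add: move_def mid_pair_def)
  show "move k (2 * k + 3, 2 * k + 3) = 1" using S(7) wt(3) by (simp add: move_def mid_pair_def)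
  have "2 * k + 2 \<noteq> 3" by presburger
  then show "move k (2 * k + 2, 2 * k + 4) = -1"
    using S(8) wt(3) unfolding move_def fst_conv snd_conv half by (simp add: mid_pair_def)
  show "move k (1, 2 * k + 4) = 2 * int k + 1" using S(9) by (simp add: move_def)
  show "move k (mid_pair k) = - (2 * int k + 1)" using S(10) by (simp add: move_def mid_pair_def)
qed

text \<open>Summation by parts: linear weights have zero second difference, so only boundary terms
  survive.\<close>

lemma sum_second_difference_up:
  fixes F :: "nat \<Rightarrow> int"
  shows "(\<Sum>i<k. 2 * int (i + 1) * (2 * F (i + 2) - F (i + 1) - F (i + 3))) =
     2 * (int (k + 1) * F (k + 1) - int k * F (k + 2) - F 1)"
  by (induction k) (simp_all add: algebra_simps eval_nat_numeral)

lemma sum_second_difference_down: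
  fixes H :: "nat \<Rightarrow> int"
  shows "(\<Sum>i<k. 2 * int (k - i) * (2 * H (i + 1) - H i - H (i + 2))) =
     2 * (int (k + 1) * H 1 - int k * H 0 - H (k + 1))"
proof (induction k)
  case (Suc k)
  \<comment> \<open>Passing from \<open>k\<close> to \<open>Suc k\<close> raises every weight by 2,
    which adds twice this telescoping sum. The new summand \<open>i = k\<close> has old weight
    0.\<close>
  have tele: "(\<Sum>i<k. 2 * H (i + 1) - H i - H (i + 2)) = H 1 - H 0 + H k - H (k + 1)" for k
    by (induction k) (simp_all add: algebra_simps eval_nat_numeral)
  have "(\<Sum>i<Suc k. 2 * int (Suc k - i) * (2 * H (i + 1) - H i - H (i + 2))) =
      (\<Sum>i<Suc k. 2 * int (k - i) * (2 * H (i + 1) - H i - H (i + 2))) +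
      2 * (\<Sum>i<Suc k. 2 * H (i + 1) - H i - H (i + 2))"
    unfolding sum_distrib_left sum.distrib[symmetric]
    by (intro sum.cong) (auto simp: algebra_simps Suc_diff_le of_nat_diff)
  also have "(\<Sum>i<Suc k. 2 * int (k - i) * (2 * H (i + 1) - H i - H (i + 2))) =
      2 * (int (k + 1) * H 1 - int k * H 0 - H (k + 1))"
    using Suc.IH by simp
  finally show ?case unfolding tele by (simp add: algebra_simps)
qed simp

text \<open>The boundary terms left by the two families cancel against the contributions of the six
  exceptional columns; on each antidiagonal the two entries are opposite.\<close>

lemma move_mem_mat_kernel:
  assumes "2 * k + 4 \<le> \<Delta>"
  shows "pair_vec \<Delta> (move k) \<in> mat_kernel (B_mat \<Delta>)"
proof -
  have supp: "(\<Sum>e\<in>set (col_pairs \<Delta>). h e * move k e) = (\<Sum>e\<in>move_supp k. h e * move k e)" for h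
    using assms by (intro sum_col_pairs_move_supp) (auto simp: move_def)
  have "(\<Sum>e\<in>move_supp k. (f (fst e) + f (snd e)) * move k e) = 0" for f :: "nat \<Rightarrow> int"
  proof -
    define F where "F n = f (2 * n)" for n
    define H where "H n = f (2 * n + 1)" for n
    have f: "f = (\<lambda>v. if even v then F (v div 2) else H (v div 2))"
      by (rule ext) (simp add: F_def H_def)
    have "(\<Sum>e\<in>move_supp k. (f (fst e) + f (snd e)) * move k e) =
       (\<Sum>i<k. move k (2 * i + 3, 2 * i + 3) * (2 * H (i + 1) - H i - H (i + 2))) +
       (\<Sum>i<k. move k (2 * i + 4, 2 * i + 4) * (2 * F (i + 2) - F (i + 1) - F (i + 3))) +
       move k (2, 2) * (2 * F 1 - H 0 - H 1) +
       move k (2 * k + 3, 2 * k + 3) * (2 * H (k + 1) - F (k + 1) - F (k + 2)) +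
       move k (1, 2 * k + 4) * (H 0 + F (k + 2) - H 1 - F (k + 1))"
      unfolding f by (rule sum_vertices_move_supp) (simp_all only: move_simps minus_minus)
    also have "(\<Sum>i<k. move k (2 * i + 3, 2 * i + 3) * (2 * H (i + 1) - H i - H (i + 2))) =
        2 * (int (k + 1) * H 1 - int k * H 0 - H (k + 1))"
      unfolding sum_second_difference_down[symmetric]
      by (intro sum.cong refl) (simp only: move_simps lessThan_iff)
    also have "(\<Sum>i<k. move k (2 * i + 4, 2 * i + 4) * (2 * F (i + 2) - F (i + 1) - F (i + 3))) =
        2 * (int (k + 1) * F (k + 1) - int k * F (k + 2) - F 1)"
      unfolding sum_second_difference_up[symmetric]
      by (intro sum.cong refl) (simp only: move_simps lessThan_iff)
    finally show ?thesis unfolding move_simps by (simp add: algebra_simps)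
  qed
  moreover have "(\<Sum>e\<in>move_supp k. h (fst e + snd e) * move k e) = 0" for h :: "nat \<Rightarrow> int"
  proof -
    have "(\<Sum>i<k. h (4 * i + 6) * (move k (2 * i + 3, 2 * i + 3) + move k (2 * i + 1, 2 * i + 5))) = 0"
      by (intro sum.neutral ballI) (simp only: move_simps lessThan_iff, simp)
    moreover have "(\<Sum>i<k. h (4 * i + 8) * (move k (2 * i + 4, 2 * i + 4) + move k (2 * i + 2, 2 * i + 6))) = 0"
      by (intro sum.neutral ballI) (simp only: move_simps lessThan_iff, simp)
    ultimately show ?thesis unfolding sum_diagonals_move_supp move_simps by simp
  qed
  ultimately show ?thesis using assms by (simp add: pair_vec_mem_mat_kernel supp)
qed

text \<open>Each family contributes \<open>2 * k * (k + 1)\<close> and the six exceptional columns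
  \<open>4 * k + 6\<close>.\<close>

lemma sum_abs_move:
  assumes "2 * k + 4 \<le> \<Delta>"
  shows "(\<Sum>e\<in>set (col_pairs \<Delta>). \<bar>move k e\<bar>) = 4 * (int k + 1)\<^sup>2 + 2"
proof -
  have "(\<Sum>e\<in>set (col_pairs \<Delta>). \<bar>move k e\<bar>) = (\<Sum>e\<in>move_supp k. \<bar>move k e\<bar>)"
    using assms by (intro sum_col_pairs_move_supp) (auto simp: move_def)
  also have "(\<Sum>e\<in>move_supp k. \<bar>move k e\<bar>) =
      (\<Sum>i<k. 4 * int (k - i)) + (\<Sum>i<k. 4 * int (i + 1)) + (4 * int k + 6)"
  proof -
    have abs: "\<bar>2 * int n\<bar> + \<bar>- (2 * int n)\<bar> = 4 * int n" for n by simp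
    have "(\<Sum>i<k. \<bar>move k (2 * i + 3, 2 * i + 3)\<bar> + \<bar>move k (2 * i + 1, 2 * i + 5)\<bar>) = (\<Sum>i<k. 4 * int (k - i))"
      by (intro sum.cong refl) (simp only: move_simps lessThan_iff abs)
    moreover have "(\<Sum>i<k. \<bar>move k (2 * i + 4, 2 * i + 4)\<bar> + \<bar>move k (2 * i + 2, 2 * i + 6)\<bar>) = (\<Sum>i<k. 4 * int (i + 1))"
      by (intro sum.cong refl) (simp only: move_simps lessThan_iff abs)
    ultimately show ?thesis unfolding sum_move_supp move_simps by simp
  qed
  also have "(\<Sum>i<k. 4 * int (k - i)) = (\<Sum>i<k. 4 * int (i + 1))"
    by (rule sum.reindex_bij_witness[of _ "\<lambda>i. k - Suc i" "\<lambda>i. k - Suc i"]) auto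
  also have "(\<Sum>i<k. 4 * int (i + 1)) = 2 * int k * (int k + 1)"
    by (induction k) (simp_all add: algebra_simps)
  finally show ?thesis by (simp add: power2_eq_square algebra_simps)
qed

text \<open>Each entry of the two families is isolated by a test function with a single kink; two linear
  test functions then relate the three remaining free entries.\<close>

lemma kernel_move_supp_unique:
  assumes \<Delta>: "2 * k + 4 \<le> \<Delta>" and ker: "pair_vec \<Delta> D \<in> mat_kernel (B_mat \<Delta>)"
    and supp: "\<And>e. e \<in> set (col_pairs \<Delta>) \<Longrightarrow> e \<notin> move_supp k \<Longrightarrow> D e = 0"
    and e: "e \<in> set (col_pairs \<Delta>)"
  shows "D e = D (2, 2) * move k e"
proof -
  have sum_supp: "(\<Sum>e\<in>set (col_pairs \<Delta>). h e * D e) = (\<Sum>e\<in>move_supp k. h e * D e)" for h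
    using \<Delta> supp by (intro sum_col_pairs_move_supp) auto
  have V: "(\<Sum>e\<in>move_supp k. (f (fst e) + f (snd e)) * D e) = 0"
    and H: "(\<Sum>e\<in>move_supp k. h (fst e + snd e) * D e) = 0" for f h :: "nat \<Rightarrow> int"
    using ker \<Delta> by (simp_all add: pair_vec_mem_mat_kernel sum_supp)
  have diag: "(\<Sum>i<k. of_bool (4 * i + 6 = \<kappa>) * (D (2 * i + 3, 2 * i + 3) + D (2 * i + 1, 2 * i + 5))) +
     (\<Sum>i<k. of_bool (4 * i + 8 = \<kappa>) * (D (2 * i + 4, 2 * i + 4) + D (2 * i + 2, 2 * i + 6))) +
     of_bool (4 = \<kappa>) * (D (2, 2) + D (1, 3)) +
     of_bool (4 * k + 6 = \<kappa>) * (D (2 * k + 3, 2 * k + 3) + D (2 * k + 2, 2 * k + 4)) +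
     of_bool (2 * k + 5 = \<kappa>) * (D (1, 2 * k + 4) + D (mid_pair k)) = 0" for \<kappa>
    using H[of "\<lambda>s. of_bool (s = \<kappa>)"] sum_diagonals_move_supp[of "\<lambda>s. of_bool (s = \<kappa>)" D k]
    by (simp only:)
  \<comment> \<open>The index sums of different brackets differ, by parity and modulo 4, so each
    antidiagonal equation involves only two columns.\<close>
  have distinct: "4 * i + 8 \<noteq> 4 * j + 6" "4 * j + 6 \<noteq> 4 * i + 8" "2 * k + 5 \<noteq> 4 * i + 6" "2 * k + 5 \<noteq> 4 * i + 8"
    "4 * i + 6 \<noteq> 2 * k + 5" "4 * i + 8 \<noteq> 2 * k + 5" "2 * k + 5 \<noteq> 4" for i j k :: nat
    by presburger+
  have delta: "of_bool b * y = (if b then y else 0)" "y * of_bool b = (if b then y else 0)"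
    for b and y :: int by auto
  have odd_eq: "D (2 * i + 1, 2 * i + 5) = - D (2 * i + 3, 2 * i + 3)" if "i < k" for i
    using diag[of "4 * i + 6"] that by (simp add: distinct delta)
  have even_eq: "D (2 * i + 2, 2 * i + 6) = - D (2 * i + 4, 2 * i + 4)" if "i < k" for i
    using diag[of "4 * i + 8"] that by (simp add: distinct delta)
  have low_eq: "D (1, 3) = - D (2, 2)"
    using diag[of 4] by (simp add: distinct)
  have high_eq: "D (2 * k + 2, 2 * k + 4) = - D (2 * k + 3, 2 * k + 3)"
    using diag[of "4 * k + 6"] by (simp add: distinct)
  have mid_eq: "D (mid_pair k) = - D (1, 2 * k + 4)"
    using diag[of "2 * k + 5"] by (simp add: distinct)
  define t t' m where "t = D (2, 2)" and "t' = D (2 * k + 3, 2 * k + 3)" and "m = D (1, 2 * k + 4)"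
  have vert: "(\<Sum>i<k. D (2 * i + 3, 2 * i + 3) * (2 * H (i + 1) - H i - H (i + 2))) +
     (\<Sum>i<k. D (2 * i + 4, 2 * i + 4) * (2 * F (i + 2) - F (i + 1) - F (i + 3))) +
     t * (2 * F 1 - H 0 - H 1) + t' * (2 * H (k + 1) - F (k + 1) - F (k + 2)) +
     m * (H 0 + F (k + 2) - H 1 - F (k + 1)) = 0" for F H
    using V[of "\<lambda>v. if even v then F (v div 2) else H (v div 2)"]
      sum_vertices_move_supp[of k D F H, OF odd_eq even_eq low_eq high_eq mid_eq]
    unfolding t_def t'_def m_def by simp
  have o: "D (2 * i + 3, 2 * i + 3) = 2 * int (k - i) * t'" if i: "i < k" for i
  proof -
    \<comment> \<open>Zero up to \<open>i + 1\<close> and of slope 1 afterwards: besides the kink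
      only \<open>H (k + 1) = k - i\<close> contributes.\<close>
    let ?H = "\<lambda>n. max 0 (int n - int (i + 1))"
    have kink: "2 * ?H (j + 1) - ?H j - ?H (j + 2) = - of_bool (j = i)" for j by (auto simp: max_def)
    have "- D (2 * i + 3, 2 * i + 3) + 2 * int (k - i) * t' = 0"
      using vert[of ?H "\<lambda>_. 0"] i unfolding kink
      by (simp add: delta sum_negf algebra_simps)
    then show ?thesis by simp
  qed
  have q: "D (2 * i + 4, 2 * i + 4) = 2 * int (i + 1) * t" if i: "i < k" for i
  proof -
    \<comment> \<open>Of slope -1 up to \<open>i + 2\<close> and zero afterwards: besides the kink
      only \<open>F 1 = i + 1\<close> contributes.\<close>
    let ?F = "\<lambda>n. max 0 (int (i + 2) - int n)"
    have kink: "2 * ?F (j + 2) - ?F (j + 1) - ?F (j + 3) = - of_bool (j = i)" for j by (auto simp: max_def)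
    have "- D (2 * i + 4, 2 * i + 4) + 2 * int (i + 1) * t = 0"
      using vert[of "\<lambda>_. 0" ?F] i unfolding kink
      by (simp add: delta sum_negf algebra_simps)
    then show ?thesis by simp
  qed
  \<comment> \<open>Linear test functions annihilate both families; the shifts make
    \<open>H 1\<close> here, and \<open>F (k + 1)\<close> in the next equation, vanish.\<close>
  have "- t - 2 * int k * t' + m = 0"
    using vert[of "\<lambda>n. 1 - int n" "\<lambda>_. 0"] by (simp add: algebra_simps)
  moreover have "- 2 * int k * t - t' + m = 0"
    using vert[of "\<lambda>_. 0" "\<lambda>n. int n - int (k + 1)"] by (simp add: algebra_simps)
  ultimately have "(2 * int k - 1) * (t' - t) = 0" and m: "m = t + 2 * int k * t'"
    by (simp_all add: algebra_simps)
  \<comment> \<open>An odd number is nonzero, which also covers \<open>k = 0\<close>.\<close>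
  moreover have "2 * int k - 1 \<noteq> 0" by presburger
  ultimately have t': "t' = t" by simp
  then have m': "m = t * (2 * int k + 1)" using m by (simp add: algebra_simps)
  show ?thesis
  proof (cases "e \<in> move_supp k")
    case False
    then show ?thesis using supp[OF e] by (simp add: move_def)
  next
    case True
    then show ?thesis
    proof (cases rule: move_supp_cases)
      case (odd i)
      from odd(2) show ?thesis
        by (elim disjE) (simp_all only: odd_eq[OF odd(1)] o[OF odd(1)] move_simps(1,2)[OF odd(1)] t' t_def[symmetric],
          simp_all add: algebra_simps)
    next
      case (even i)
      from even(2) show ?thesis
        by (elim disjE) (simp_all only: even_eq[OF even(1)] q[OF even(1)] move_simps(3,4)[OF even(1)] t_def[symmetric],
          simp_all add: algebra_simps)
    next
      case low
      moreover have "D (2, 2) = D (2, 2) * move k (2, 2)" "D (1, 3) = D (2, 2) * move k (1, 3)"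
        unfolding low_eq move_simps by simp_all
      ultimately show ?thesis by metis
    next
      case high
      moreover have "D (2 * k + 3, 2 * k + 3) = D (2, 2) * move k (2 * k + 3, 2 * k + 3)"
        "D (2 * k + 2, 2 * k + 4) = D (2, 2) * move k (2 * k + 2, 2 * k + 4)"
        unfolding high_eq move_simps using t' by (simp_all add: t_def t'_def)
      ultimately show ?thesis by metis
    next
      case mid
      moreover have "D (1, 2 * k + 4) = D (2, 2) * move k (1, 2 * k + 4)"
        "D (mid_pair k) = D (2, 2) * move k (mid_pair k)"
        unfolding mid_eq move_simps using m' by (simp_all add: t_def m_def algebra_simps)
      ultimately show ?thesis by metis
    qed
  qed
qed

text \<open>A kernel vector conformal to the move has its support inside \<open>move_supp k\<close>,
  hence is a multiple of the move, and the entry 1 at \<open>(2, 2)\<close> restricts the factor to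
  0 or 1.\<close>

lemma move_mem_graver:
  assumes \<Delta>: "2 * k + 4 \<le> \<Delta>"
  shows "pair_vec \<Delta> (move k) \<in> graver (B_mat \<Delta>)"
proof -
  have dim: "dim_col (B_mat \<Delta>) = Suc \<Delta> choose 2" by (simp add: B_mat_def)
  have in22: "(2, 2) \<in> set (col_pairs \<Delta>)" using \<Delta> by (simp add: set_col_pairs)
  have zero: "0\<^sub>v (Suc \<Delta> choose 2) = pair_vec \<Delta> (\<lambda>_. 0)" by (auto simp: pair_vec_def)
  have eq: "pair_vec \<Delta> D = pair_vec \<Delta> E \<longleftrightarrow> (\<forall>e\<in>set (col_pairs \<Delta>). D e = E e)" for D E
    using pair_vec_all_iff[of \<Delta> "(=)" D E] by (auto simp: vec_eq_iff)
  have "pair_vec \<Delta> (move k) \<noteq> 0\<^sub>v (Suc \<Delta> choose 2)"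
    unfolding zero eq using in22 move_simps(5)[of k] by (auto intro!: bexI[of _ "(2, 2)"])
  moreover have "v = 0\<^sub>v (Suc \<Delta> choose 2) \<or> v = pair_vec \<Delta> (move k)"
    if v: "v \<in> mat_kernel (B_mat \<Delta>)" "conformal v (pair_vec \<Delta> (move k))" for v
  proof -
    obtain D where D: "v = pair_vec \<Delta> D"
      using ex_pair_vec[of v \<Delta>] v(2) by (auto simp: conformal_def)
    have between: "between0 (D e) (move k e)" if "e \<in> set (col_pairs \<Delta>)" for e
      using v(2) that pair_vec_all_iff[of \<Delta> between0 D "move k"] by (simp add: D conformal_def)
    have "D e = 0" if "e \<in> set (col_pairs \<Delta>)" "e \<notin> move_supp k" for e
      using between[OF that(1)] that(2) by (auto simp: between0_def move_def)
    then have D22: "D e = D (2, 2) * move k e" if "e \<in> set (col_pairs \<Delta>)" for e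
      using kernel_move_supp_unique[OF \<Delta>] v(1) that unfolding D by blast
    have "D (2, 2) = 0 \<or> D (2, 2) = 1"
      using between[OF in22] by (auto simp: between0_def move_simps)
    then show ?thesis unfolding D zero eq using D22 by fastforce
  qed
  ultimately show ?thesis
    using move_mem_mat_kernel[OF \<Delta>] by (auto simp: graver_def dim)
qed

section \<open>Minimal Markov bases of the lifted matrix and the degree of the move\<close>

theorem corollary3p6:
  fixes \<Delta> :: nat
  assumes "\<Delta> \<ge> 4"
  shows "(\<exists>M. minimal_markov_basis (lawrence_lifting (B_mat \<Delta>)) M) \<and>
    (\<forall>M M'. minimal_markov_basis (lawrence_lifting (B_mat \<Delta>)) M \<longrightarrow>
       minimal_markov_basis (lawrence_lifting (B_mat \<Delta>)) M' \<longrightarrow> equal_up_to_signs M M') \<and>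
    (\<forall>M. minimal_markov_basis (lawrence_lifting (B_mat \<Delta>)) M \<longrightarrow>
       (\<exists>b\<in>M. move_degree b = 4 * (\<lfloor>real \<Delta> / 2\<rfloor> - 1)\<^sup>2 + 2))"
proof (intro conjI allI impI)
  show "\<exists>M. minimal_markov_basis (lawrence_lifting (B_mat \<Delta>)) M"
    by (rule ex_minimal_markov_basis)
  show "equal_up_to_signs M M'"
    if "minimal_markov_basis (lawrence_lifting (B_mat \<Delta>)) M"
      "minimal_markov_basis (lawrence_lifting (B_mat \<Delta>)) M'" for M M'
    using that graver_in_markov_basis_lawrence_lifting by (rule minimal_markov_basis_unique)
  show "\<exists>b\<in>M. move_degree b = 4 * (\<lfloor>real \<Delta> / 2\<rfloor> - 1)\<^sup>2 + 2"
    if M: "minimal_markov_basis (lawrence_lifting (B_mat \<Delta>)) M" for M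
  proof -
    \<comment> \<open>The largest \<open>k\<close> for which all columns of the move exist;
      \<open>\<Delta> \<ge> 4\<close> makes the truncated subtraction exact.\<close>
    define k where "k = \<Delta> div 2 - 2"
    have k: "2 * k + 4 \<le> \<Delta>" "\<lfloor>real \<Delta> / 2\<rfloor> - 1 = int k + 1"
      using assms floor_divide_of_nat_eq[of \<Delta> 2, where ?'a = real] by (auto simp: k_def)
    define g where "g = pair_vec \<Delta> (move k)"
    have "g @\<^sub>v - g \<in> graver (lawrence_lifting (B_mat \<Delta>))"
      unfolding g_def using move_mem_graver[OF k(1)] by (rule graver_lawrence_lifting)
    \<comment> \<open>Only one sign is known to occur in \<open>M\<close>, but both have the same
      degree.\<close>
    then have "g @\<^sub>v - g \<in> M \<or> - g @\<^sub>v - (- g) \<in> M"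
      using graver_in_markov_basis_lawrence_lifting M
      unfolding minimal_markov_basis_def by (metis uminus_append_vec)
    moreover have "move_degree (g @\<^sub>v - g) = 4 * (int k + 1)\<^sup>2 + 2"
      unfolding move_degree_append_uminus using sum_abs_pair_vec sum_abs_move[OF k(1)]
      by (simp add: g_def)
    moreover have "move_degree (- g @\<^sub>v - (- g)) = move_degree (g @\<^sub>v - g)"
      unfolding move_degree_append_uminus by simp
    ultimately show ?thesis unfolding k(2) by metis
  qed
qed

end
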